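(* Let $G$ be a finite abelian group of order $|G|=n$. For every positive integer $m$, one has $$|\mathsf M(G,-m)|=(-1)^{n-1}\,|\mathsf M^\circ(G,m)|,$$ where $\mathsf M^\circ(G,m)=\{S\in\mathsf M(G,m):\operatorname{supp}(S)=G\}$ is the set of zero-sum sequences over $G$ of length $m$ in which every element of $G$ occurs with positive multiplicity, and $|\mathsf M(G,-m)|$ denotes the value at $-m$ of the quasipolynomial $L_G$ that agrees with $|\mathsf M(G,\cdot)|$ on positive integers.
   Context: $G$ is written additively. A sequence $S$ over $G$ is a finite unordered sequence of elements of $G$ with repetitions allowed, identified with its multiplicity vector $(a_g)_{g\in G}\in\mathbb Z_{\ge 0}^G$. Its length is $|S|=\sum_g a_g$, its sum is $\sigma(S)=\sum_g a_g g\in G$, and its support is $\operatorname{supp}(S)=\{g\in G: a_g>0\}$. $S$ is zero-sum if $\sigma(S)=0$. $\mathsf M(G,m)$ is the set of zero-sum sequences over $G$ of length $m$. The function $m\mapsto|\mathsf M(G,m)|$ on positive integers is the restriction of a unique quasipolynomial $L_G:\mathbb Z\to\mathbb Q$ (a function given by a polynomial in $m$ on each residue class modulo some fixed period). Explicitly, with $\varphi_G(d)$ the number of elements of $G$ of order $d$, $$L_G(m)=\frac1n\sum_{d\mid (n,m)}\varphi_G(d)\binom{m/d+n/d-1}{n/d-1},$$ where $\binom{x}{k}=x(x-1)\cdots(x-k+1)/k!$. The notation $|\mathsf M(G,-m)|$ means $L_G(-m)$. *)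

theory Defs
  imports
    "HOL-Library.Multiset"
    "HOL-Library.Cardinality"
    "HOL-Number_Theory.Cong"
    "HOL-Computational_Algebra.Polynomial"
begin

text \<open>
  The finite abelian group \<open>G\<close> is the type \<open>'a\<close>, of class \<open>{ab_group_add, finite}\<close>. A sequence over
  \<open>G\<close> is a multiset: \<open>count S g\<close> is the multiplicity of \<open>g\<close>, \<open>size S\<close> the length, \<open>sum_mset S\<close>
  the sum and \<open>set_mset S\<close> the support.
\<close>

definition zero_sum_seqs :: "nat \<Rightarrow> 'a::{ab_group_add, finite} multiset set" where
  "zero_sum_seqs m = {S. size S = m \<and> sum_mset S = 0}"

definition full_zero_sum_seqs :: "nat \<Rightarrow> 'a::{ab_group_add, finite} multiset set" where
  "full_zero_sum_seqs m = {S \<in> zero_sum_seqs m. set_mset S = UNIV}"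

definition quasipolynomial :: "(int \<Rightarrow> rat) \<Rightarrow> bool" where
  "quasipolynomial f \<longleftrightarrow>
     (\<exists>N>0. \<forall>r. \<exists>p :: rat poly. \<forall>m. [m = r] (mod N) \<longrightarrow> f m = poly p (of_int m))"

text \<open>
  The quasipolynomial that agrees with the number of zero-sum sequences of length \<open>m\<close> at all
  positive \<open>m\<close>. The value at \<open>0\<close> and at negative integers is not prescribed, but determined by
  uniqueness. The type argument stands for the group \<open>G\<close>.
\<close>

definition zero_sum_quasipoly :: "'a::{ab_group_add, finite} itself \<Rightarrow> int \<Rightarrow> rat" where
  "zero_sum_quasipoly _ =
     (THE L. quasipolynomial L \<and>
        (\<forall>m::nat. m > 0 \<longrightarrow> L (int m) = of_nat (card (zero_sum_seqs m :: 'a multiset set))))"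

end

theory Submission
  imports Defs
begin

text \<open>
  Every element of \<open>G\<close> is killed by \<open>n = |G|\<close>. Dividing the multiplicities by \<open>n\<close> with remainder
  writes a zero-sum sequence uniquely as \<open>R + n Q\<close>, where \<open>R\<close> is zero-sum with multiplicities
  below \<open>n\<close> and \<open>Q\<close> is arbitrary. Hence the number of zero-sum sequences of length \<open>m\<close> is a sum over
  \<open>R\<close> with \<open>n\<close> dividing \<open>m - |R|\<close> of \<open>binomial (k + n - 1) (n - 1)\<close>, where \<open>k = (m - |R|) / n\<close>. Since
  \<open>|R| \<le> n (n - 1)\<close>, a negative \<open>k\<close> is above \<open>-n\<close>, so its binomial coefficient vanishes, and the
  sum is a quasipolynomial for all \<open>m > 0\<close>.
  A zero-sum sequence with full support is in
  the same way uniquely of the form \<open>n (Q + G) - R\<close>, which yields the same sum at \<open>-m\<close> up to the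
  sign from \<open>binomial (-k + n - 1) (n - 1) = (-1)^(n-1) binomial (k - 1) (n - 1)\<close>.
\<close>

section \<open>Finite abelian groups and multisets over a finite type\<close>

lemma sum_UNIV_const_eq_0:
  fixes x :: "'a::{ab_group_add, finite}"
  shows "(\<Sum>g\<in>(UNIV :: 'a set). x) = 0"
proof -
  \<comment> \<open>Translation by \<open>x\<close> permutes the group; cancelling the sum of all
    elements leaves the constant sum.\<close>
  have "(\<Sum>g\<in>UNIV. g) = (\<Sum>g\<in>UNIV. g + x)"
    by (rule sum.reindex_bij_betw[of "\<lambda>g. g + x", symmetric])
      (auto intro!: bij_betw_byWitness[where f' = "\<lambda>g. g - x"])
  then show ?thesis
    by (simp add: sum.distrib)
qed

lemma sum_mset_repeat_mset_CARD:
  fixes Q :: "'a::{ab_group_add, finite} multiset"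
  shows "sum_mset (repeat_mset CARD('a) Q) = 0"
proof -
  \<comment> \<open>The number of repetitions becomes the cardinality of an arbitrary finite set, so
    that set induction applies; at \<open>A = UNIV\<close> the constant sum vanishes.\<close>
  have "sum_mset (repeat_mset (card A) Q) = (\<Sum>g\<in>A. sum_mset Q)" if "finite A" for A :: "'a set"
    using that by induction auto
  then show ?thesis
    by (simp add: sum_UNIV_const_eq_0)
qed

lemma size_multiset_UNIV:
  fixes S :: "'a::finite multiset"
  shows "size S = (\<Sum>g\<in>UNIV. count S g)"
  unfolding size_multiset_overloaded_eq
  by (rule sum.mono_neutral_left) (auto simp: not_in_iff)

text \<open>Stars and bars: along an enumeration \<open>h\<close> of the type, the multiplicities
  form a list of \<open>CARD('a)\<close> naturals with sum \<open>k\<close>.\<close>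

lemma card_multisets_of_size:
  "card {Q :: 'a::finite multiset. size Q = k} = (k + CARD('a) - 1) choose (CARD('a) - 1)"
proof -
  let ?n = "CARD('a)"
  obtain h :: "nat \<Rightarrow> 'a" where h: "bij_betw h {0..<?n} UNIV"
    using ex_bij_betw_nat_finite[of "UNIV :: 'a set"] by auto
  define j where "j = inv_into {0..<?n} h"
  have hj: "h (j g) = g" for g
    using h by (simp add: j_def bij_betw_inv_into_right)
  have jh: "j (h i) = i" if "i < ?n" for i
    using h that by (simp add: j_def bij_betw_inv_into_left)
  have jn: "j g < ?n" for g
    using bij_betwE[OF bij_betw_inv_into[OF h]] by (auto simp: j_def)
  have size_eq: "size Q = (\<Sum>i<?n. count Q (h i))" for Q
    unfolding size_multiset_UNIV using sum.reindex_bij_betw[OF h, of "count Q"]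
    by (simp add: atLeast0LessThan)
  have "bij_betw (\<lambda>Q. map (\<lambda>i. count Q (h i)) [0..<?n]) {Q :: 'a multiset. size Q = k}
          {l :: nat list. length l = ?n \<and> sum_list l = k}"
  proof (rule bij_betw_byWitness[where f' = "\<lambda>l. Abs_multiset (\<lambda>g. l ! j g)"])
    show "\<forall>Q\<in>{Q :: 'a multiset. size Q = k}.
        Abs_multiset (\<lambda>g. map (\<lambda>i. count Q (h i)) [0..<?n] ! j g) = Q"
      by (simp add: jn hj)
    show "\<forall>l\<in>{l :: nat list. length l = ?n \<and> sum_list l = k}.
        map (\<lambda>i. count (Abs_multiset (\<lambda>g. l ! j g)) (h i)) [0..<?n] = l"
      by (auto intro!: nth_equalityI simp: Abs_multiset_inverse jh)
    show "(\<lambda>Q. map (\<lambda>i. count Q (h i)) [0..<?n]) ` {Q :: 'a multiset. size Q = k}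
        \<subseteq> {l :: nat list. length l = ?n \<and> sum_list l = k}"
      by (auto simp: size_eq interv_sum_list_conv_sum_set_nat atLeast0LessThan)
    show "(\<lambda>l. Abs_multiset (\<lambda>g. l ! j g)) ` {l :: nat list. length l = ?n \<and> sum_list l = k}
        \<subseteq> {Q :: 'a multiset. size Q = k}"
      by (auto simp: size_eq Abs_multiset_inverse jh sum_list_sum_nth atLeast0LessThan)
  qed
  then have "card {Q :: 'a multiset. size Q = k} = (k + ?n - 1) choose k"
    by (simp add: bij_betw_same_card card_length_sum_list)
  also have "\<dots> = (k + ?n - 1) choose (?n - 1)"
    using binomial_symmetric[of k "k + ?n - 1"] zero_less_card_finite[where 'a = 'a]
    by (simp del: zero_less_card_finite)
  finally show ?thesis .
qed

text \<open>An infinite set has \<open>card\<close> 0, whereas this binomial coefficient is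
  positive.\<close>

lemma finite_multisets_of_size: "finite {Q :: 'a::finite multiset. size Q = k}"
  by (rule card_ge_0_finite) (simp add: card_multisets_of_size Suc_leI)

section \<open>Division of the multiplicities by the group order\<close>

definition residual_seqs :: "'a::{ab_group_add, finite} multiset set" where
  "residual_seqs = {R. (\<forall>g. count R g < CARD('a)) \<and> sum_mset R = 0}"

lemma size_residual_le:
  fixes R :: "'a::{ab_group_add, finite} multiset"
  assumes "R \<in> residual_seqs"
  shows "size R \<le> CARD('a) * (CARD('a) - 1)"
proof -
  have "(\<Sum>g\<in>UNIV. count R g) \<le> of_nat (card (UNIV :: 'a set)) * (CARD('a) - 1)"
    using assms by (intro sum_bounded_above) (auto simp: residual_seqs_def less_Suc_eq_le[symmetric])
  then show ?thesis
    by (simp add: size_multiset_UNIV)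
qed

lemma finite_residual_seqs: "finite (residual_seqs :: 'a::{ab_group_add, finite} multiset set)"
proof (rule finite_subset)
  show "(residual_seqs :: 'a multiset set)
      \<subseteq> (\<Union>k\<le>CARD('a) * (CARD('a) - 1). {Q. size Q = k})"
    using size_residual_le by auto
qed (simp add: finite_multisets_of_size)

lemma card_zero_sum_seqs:
  "card (zero_sum_seqs m :: 'a::{ab_group_add, finite} multiset set) =
     (\<Sum>R\<in>(residual_seqs :: 'a multiset set). card {Q :: 'a multiset. size R + CARD('a) * size Q = m})"
proof -
  let ?n = "CARD('a)"
  let ?X = "SIGMA R:(residual_seqs :: 'a multiset set). {Q :: 'a multiset. size R + ?n * size Q = m}"
  define r where "r S = Abs_multiset (\<lambda>g. count S g mod ?n)" for S :: "'a multiset"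
  define q where "q S = Abs_multiset (\<lambda>g. count S g div ?n)" for S :: "'a multiset"
  have [simp]: "count (r S) g = count S g mod ?n" "count (q S) g = count S g div ?n" for S g
    by (simp_all add: r_def q_def Abs_multiset_inverse)
  have decomp: "r S + repeat_mset ?n (q S) = S" for S
    by (rule multiset_eqI) simp
  \<comment> \<open>The \<open>n\<close>-fold part sums to 0, so passing to the remainder preserves
    the sum.\<close>
  have sum_r: "sum_mset (r S) = sum_mset S" for S
    using arg_cong[OF decomp[of S], of sum_mset] by (simp add: sum_mset_repeat_mset_CARD)
  have size_r: "size (r S) + ?n * size (q S) = size S" for S
    using arg_cong[OF decomp[of S], of size] by simp
  have "bij_betw (\<lambda>(R, Q). R + repeat_mset ?n Q) ?X (zero_sum_seqs m)"
  proof (rule bij_betw_byWitness[where f' = "\<lambda>S. (r S, q S)"])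
    show "\<forall>x\<in>?X. (\<lambda>S. (r S, q S)) ((\<lambda>(R, Q). R + repeat_mset ?n Q) x) = x"
      by (auto simp: residual_seqs_def intro!: multiset_eqI)
    show "\<forall>S\<in>zero_sum_seqs m. (\<lambda>(R, Q). R + repeat_mset ?n Q) (r S, q S) = S"
      by (simp add: decomp)
    show "(\<lambda>(R, Q). R + repeat_mset ?n Q) ` ?X \<subseteq> zero_sum_seqs m"
      by (auto simp: zero_sum_seqs_def residual_seqs_def sum_mset_repeat_mset_CARD)
    show "(\<lambda>S. (r S, q S)) ` zero_sum_seqs m \<subseteq> ?X"
      by (auto simp: zero_sum_seqs_def residual_seqs_def sum_r size_r)
  qed
  moreover have "finite {Q :: 'a multiset. size R + ?n * size Q = m}" for R :: "'a multiset"
    by (rule finite_subset[OF _ finite_multisets_of_size[of "(m - size R) div ?n"]]) auto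
  ultimately show ?thesis
    by (simp add: bij_betw_same_card[THEN sym] finite_residual_seqs flip: card_SigmaI)
qed

lemma card_full_zero_sum_seqs:
  "card (full_zero_sum_seqs m :: 'a::{ab_group_add, finite} multiset set) =
     (\<Sum>R\<in>(residual_seqs :: 'a multiset set). card {Q :: 'a multiset. CARD('a) * (size Q + CARD('a)) = m + size R})"
proof -
  let ?n = "CARD('a)"
  let ?X = "SIGMA R:(residual_seqs :: 'a multiset set). {Q :: 'a multiset. ?n * (size Q + ?n) = m + size R}"
  define f where "f R Q = Abs_multiset (\<lambda>g. ?n * (count Q g + 1) - count R g)"
    for R Q :: "'a multiset"
  \<comment> \<open>A multiplicity \<open>s > 0\<close> lies in exactly one interval from
    \<open>n * c + 1\<close> to \<open>n * (c + 1)\<close>, namely for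
    \<open>c = (s - 1) div n\<close>. The remainder is the distance to the right end, hence 0 for
    multiples of \<open>n\<close>.\<close>
  define q where "q S = Abs_multiset (\<lambda>g. (count S g - 1) div ?n)" for S :: "'a multiset"
  define r where "r S = Abs_multiset (\<lambda>g. ?n * ((count S g - 1) div ?n + 1) - count S g)"
    for S :: "'a multiset"
  have count_eqs [simp]: "count (f R Q) g = ?n * (count Q g + 1) - count R g"
    "count (q S) g = (count S g - 1) div ?n"
    "count (r S) g = ?n * ((count S g - 1) div ?n + 1) - count S g" for S R Q g
    by (simp_all add: f_def r_def q_def Abs_multiset_inverse)
  \<comment> \<open>The relation between \<open>S\<close>, \<open>R\<close> and \<open>Q\<close> is
    stated additively because multiset subtraction truncates; \<open>mset_set UNIV\<close> takes
    every group element once.\<close>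
  have relD: "sum_mset S + sum_mset R = 0" "size S + size R = ?n * (size Q + ?n)"
    if "S + R = repeat_mset ?n (Q + mset_set UNIV)" for S R Q :: "'a multiset"
  proof -
    show "sum_mset S + sum_mset R = 0"
      using arg_cong[OF that, of sum_mset] sum_mset_repeat_mset_CARD[of "Q + mset_set UNIV"]
      by (simp del: repeat_mset_distrib2)
    show "size S + size R = ?n * (size Q + ?n)"
      using arg_cong[OF that, of size] by (simp del: repeat_mset_distrib2)
  qed
  have small: "count R g < ?n" if "R \<in> residual_seqs" for R :: "'a multiset" and g
    using that by (simp add: residual_seqs_def)
  have rel_f: "f R Q + R = repeat_mset ?n (Q + mset_set UNIV)" if "R \<in> residual_seqs" for R Q
    using small[OF that] by (intro multiset_eqI) (simp add: less_imp_le_nat trans_le_add1)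
  \<comment> \<open>The difference equals \<open>n - 1 - (s - 1) mod n\<close>, which lies between 0
    and \<open>n - 1\<close>.\<close>
  have aux: "s \<le> ?n * ((s - 1) div ?n + 1) \<and> ?n * ((s - 1) div ?n + 1) - s < ?n" if "s > 0" for s
  proof -
    have "?n * ((s - 1) div ?n) + (s - 1) mod ?n = s - 1" and "(s - 1) mod ?n < ?n"
      by simp_all
    then show ?thesis
      using that by (simp only: distrib_left) linarith
  qed
  have pos: "count S g > 0" if "S \<in> full_zero_sum_seqs m" for S :: "'a multiset" and g
    using that by (auto simp: full_zero_sum_seqs_def)
  have rel_r: "S + r S = repeat_mset ?n (q S + mset_set UNIV)"
    if "S \<in> full_zero_sum_seqs m" for S
    using aux[OF pos[OF that]] by (intro multiset_eqI) simp
  have "bij_betw (\<lambda>(R, Q). f R Q) ?X (full_zero_sum_seqs m)"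
  proof (rule bij_betw_byWitness[where f' = "\<lambda>S. (r S, q S)"])
    have div_eq: "(?n * (c + 1) - a - 1) div ?n = c" if "a < ?n" for a c
      using that by (intro div_nat_eqI) (auto simp: algebra_simps)
    have "q (f R Q) = Q" if "R \<in> residual_seqs" for R Q
      using small[OF that] by (intro multiset_eqI) (simp only: count_eqs div_eq)
    moreover have "r (f R Q) = R" if "R \<in> residual_seqs" for R Q
      using small[OF that] by (intro multiset_eqI)
        (simp only: count_eqs div_eq,
         simp add: less_imp_le_nat trans_le_add1)
    ultimately show "\<forall>x\<in>?X. (\<lambda>S. (r S, q S)) ((\<lambda>(R, Q). f R Q) x) = x"
      by auto
    show "\<forall>S\<in>full_zero_sum_seqs m. (\<lambda>(R, Q). f R Q) (r S, q S) = S"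
      using aux pos by (auto intro!: multiset_eqI)
    show "(\<lambda>(R, Q). f R Q) ` ?X \<subseteq> full_zero_sum_seqs m"
    proof clarify
      fix R Q :: "'a multiset"
      assume R: "R \<in> residual_seqs" and Q: "?n * (size Q + ?n) = m + size R"
      have "count (f R Q) g > 0" for g
        using small[OF R, of g] by (simp add: trans_less_add1)
      then have "set_mset (f R Q) = UNIV"
        by (metis UNIV_eq_I count_greater_zero_iff)
      then show "f R Q \<in> full_zero_sum_seqs m"
        using relD[OF rel_f[OF R, of Q]] R Q
        by (simp add: full_zero_sum_seqs_def zero_sum_seqs_def residual_seqs_def)
    qed
    show "(\<lambda>S. (r S, q S)) ` full_zero_sum_seqs m \<subseteq> ?X"
    proof (rule image_subsetI)
      fix S :: "'a multiset"
      assume S: "S \<in> full_zero_sum_seqs m"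
      have "\<forall>g. count (r S) g < ?n"
        using aux[OF pos[OF S]] by simp
      then show "(r S, q S) \<in> ?X"
        using relD[OF rel_r[OF S]] S
        by (simp add: full_zero_sum_seqs_def zero_sum_seqs_def residual_seqs_def)
    qed
  qed
  moreover have "finite {Q :: 'a multiset. ?n * (size Q + ?n) = m + size R}" for R :: "'a multiset"
  proof (rule finite_subset[OF _ finite_multisets_of_size])
    show "{Q :: 'a multiset. ?n * (size Q + ?n) = m + size R}
        \<subseteq> {Q. size Q = (m + size R) div ?n - ?n}"
    proof (intro Collect_mono impI)
      fix Q :: "'a multiset"
      assume "?n * (size Q + ?n) = m + size R"
      from this[symmetric] show "size Q = (m + size R) div ?n - ?n"
        by simp
    qed
  qed
  ultimately show ?thesis
    by (simp add: bij_betw_same_card[THEN sym] finite_residual_seqs flip: card_SigmaI)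
qed

section \<open>Fibre counts as a generalized binomial coefficient, polynomial on one residue
  class\<close>

definition residue_term :: "nat \<Rightarrow> nat \<Rightarrow> int \<Rightarrow> rat" where
  "residue_term n s x =
     (if int n dvd x - int s
      then (of_int ((x - int s) div int n) + of_nat n - 1) gchoose (n - 1) else 0)"

lemma residue_term_eq:
  assumes "x - int s = int n * k" and "n > 0"
  shows "residue_term n s x = (of_int (k + int n - 1)) gchoose (n - 1)"
  using assms by (simp add: residue_term_def)

lemma card_residue_fibre:
  fixes R :: "'a::{ab_group_add, finite} multiset"
  assumes "R \<in> residual_seqs"
  shows "of_nat (card {Q :: 'a multiset. size R + CARD('a) * size Q = m}) =
    residue_term CARD('a) (size R) (int m)"
proof (cases "int CARD('a) dvd int m - int (size R)")
  case False
  have "{Q :: 'a multiset. size R + CARD('a) * size Q = m} = {}"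
    using False by auto
  with False show ?thesis
    by (simp add: residue_term_def)
next
  case True
  let ?n = "CARD('a)"
  have n: "?n > 0" by simp
  from True obtain k where k: "int m - int (size R) = int ?n * k"
    by (elim dvdE)
  have fibre: "size R + ?n * t = m \<longleftrightarrow> int t = k" for t
  proof -
    have "size R + ?n * t = m \<longleftrightarrow> int ?n * int t = int m - int (size R)"
      by (simp flip: of_nat_mult) linarith
    then show ?thesis
      using n by (simp add: k)
  qed
  \<comment> \<open>This bound gives \<open>n * k = m - size R \<ge> - n * (n - 1)\<close>, so the
    upper index \<open>k + n - 1\<close> is a natural number and the generalized coefficient is an
    ordinary one.\<close>
  have "int (size R) \<le> int ?n * int (?n - 1)"
    using size_residual_le[OF assms] unfolding of_nat_mult[symmetric] of_nat_le_iff .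
  then have "int ?n * k \<ge> int ?n * (- int (?n - 1))"
    unfolding mult_minus_right using k of_nat_0_le_iff[of m] by linarith
  then have "k \<ge> - int (?n - 1)"
    using n by (simp only: mult_le_cancel_left_pos of_nat_0_less_iff)
  then have "k + int ?n - 1 \<ge> 0"
    using n by linarith
  then obtain b where b: "k + int ?n - 1 = int b"
    by (elim nonneg_int_cases)
  have term_eq: "residue_term ?n (size R) (int m) = of_nat (b choose (?n - 1))"
    unfolding residue_term_eq[OF k n] b by (simp add: binomial_gbinomial)
  show ?thesis
  proof (cases "k \<ge> 0")
    case True
    then obtain t where t: "k = int t"
      by (elim nonneg_int_cases)
    then have "b = t + ?n - 1"
      using b n by linarith
    then show ?thesis
      by (simp add: term_eq fibre t card_multisets_of_size)
  next
    case False
    then have "b < ?n - 1"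
      using b by linarith
    moreover have "{Q :: 'a multiset. int (size Q) = k} = {}"
      using False by auto
    ultimately show ?thesis
      by (simp add: term_eq fibre)
  qed
qed

lemma card_residue_fibre_full:
  fixes R :: "'a::{ab_group_add, finite} multiset"
  assumes "m > 0"
  shows "of_nat (card {Q :: 'a multiset. CARD('a) * (size Q + CARD('a)) = m + size R}) =
    (-1) ^ (CARD('a) - 1) * residue_term CARD('a) (size R) (- int m)"
proof (cases "CARD('a) dvd m + size R")
  case False
  then have "\<not> int CARD('a) dvd - int m - int (size R)"
    by (metis dvd_minus_iff int_dvd_int_iff minus_diff_eq diff_minus_eq_add of_nat_add add.commute)
  moreover have "{Q :: 'a multiset. CARD('a) * (size Q + CARD('a)) = m + size R} = {}"
    using False by (auto dest: sym)
  ultimately show ?thesis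
    by (simp add: residue_term_def)
next
  case True
  let ?n = "CARD('a)"
  have n: "?n > 0" by simp
  from True obtain k where k: "m + size R = ?n * k"
    by (elim dvdE)
  \<comment> \<open>Positivity of \<open>m\<close> enters here and makes the natural number
    \<open>k - 1\<close> an honest difference.\<close>
  have k_pos: "k > 0"
    using assms k by (cases k) auto
  have "int m + int (size R) = int ?n * int k"
    using k by (simp flip: of_nat_mult of_nat_add)
  then have "- int m - int (size R) = int ?n * (- int k)"
    by simp
  then have "residue_term ?n (size R) (- int m) = of_int (- int k + int ?n - 1) gchoose (?n - 1)"
    using n by (rule residue_term_eq)
  also have "\<dots> = (-1) ^ (?n - 1) *
      ((of_nat (?n - 1) - of_int (- int k + int ?n - 1) - 1) gchoose (?n - 1))"
    by (rule gbinomial_negated_upper)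
  also have "(of_nat (?n - 1) - of_int (- int k + int ?n - 1) - 1 :: rat) = of_nat (k - 1)"
    using n k_pos by (simp add: of_nat_diff)
  finally have term_eq: "(-1) ^ (?n - 1) * residue_term ?n (size R) (- int m) =
      of_nat ((k - 1) choose (?n - 1))"
    by (simp add: binomial_gbinomial flip: mult.assoc power_add)
  have fibre: "{Q :: 'a multiset. ?n * (size Q + ?n) = m + size R} = {Q. size Q + ?n = k}"
    by (simp add: k)
  \<comment> \<open>For \<open>k \<ge> n\<close> the multisets \<open>Q\<close> have size
    \<open>k - n\<close>, and stars and bars gives the upper index
    \<open>(k - n) + n - 1 = k - 1\<close>. For \<open>k < n\<close> both sides are 0.\<close>
  show ?thesis
  proof (cases "k \<ge> ?n")
    case True
    then have "{Q :: 'a multiset. size Q + ?n = k} = {Q. size Q = k - ?n}"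
      by auto
    then show ?thesis
      unfolding term_eq fibre using True by (simp add: card_multisets_of_size)
  next
    case False
    then have "{Q :: 'a multiset. size Q + ?n = k} = {}"
      by auto
    with False show ?thesis
      unfolding term_eq fibre using k_pos by simp
  qed
qed

section \<open>Closure and uniqueness of quasipolynomials\<close>

lemma quasipolynomial_sum:
  assumes "finite A" and "\<And>a. a \<in> A \<Longrightarrow> quasipolynomial (f a)"
  shows "quasipolynomial (\<lambda>x. \<Sum>a\<in>A. f a x)"
  using assms
proof induction
  case empty
  have "\<forall>r. \<exists>p :: rat poly. \<forall>m. [m = r] (mod 1) \<longrightarrow> 0 = poly p (of_int m)"
    by (metis poly_0)
  then show ?case
    unfolding quasipolynomial_def by (auto intro!: exI[of _ "1::int"])
next
  case (insert a A)
  from insert.prems obtain N where N: "N > 0"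
    "\<And>r. \<exists>p :: rat poly. \<forall>m. [m = r] (mod N) \<longrightarrow> f a m = poly p (of_int m)"
    unfolding quasipolynomial_def by blast
  from insert.IH insert.prems obtain M where M: "M > 0"
    "\<And>r. \<exists>p :: rat poly. \<forall>m. [m = r] (mod M) \<longrightarrow> (\<Sum>a\<in>A. f a m) = poly p (of_int m)"
    unfolding quasipolynomial_def by blast
  \<comment> \<open>The product of the two periods is a common period.\<close>
  have "\<exists>p :: rat poly. \<forall>m. [m = r] (mod (N * M)) \<longrightarrow> (\<Sum>a\<in>insert a A. f a m) = poly p (of_int m)"
    for r
  proof -
    obtain p p' :: "rat poly" where "\<And>m. [m = r] (mod N) \<Longrightarrow> f a m = poly p (of_int m)"
      "\<And>m. [m = r] (mod M) \<Longrightarrow> (\<Sum>a\<in>A. f a m) = poly p' (of_int m)"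
      using N(2) M(2) by metis
    then have "[m = r] (mod (N * M)) \<longrightarrow> (\<Sum>a\<in>insert a A. f a m) = poly (p + p') (of_int m)" for m
      using insert.hyps cong_modulus_mult[of m r N M] cong_modulus_mult[of m r M N]
      by (simp add: mult.commute)
    then show ?thesis by blast
  qed
  then show ?case
    unfolding quasipolynomial_def using N(1) M(1) by (intro exI[of _ "N * M"]) auto
qed

text \<open>In the class of any \<open>r\<close> modulo a common period there are infinitely many
  positive integers, so the two polynomials on that class coincide and agree at \<open>r\<close>
  itself, whatever its sign.\<close>

lemma quasipolynomial_eqI:
  assumes "quasipolynomial f" and "quasipolynomial g"
    and eq: "\<And>m :: nat. m > 0 \<Longrightarrow> f (int m) = g (int m)"
  shows "f = g"
proof
  fix r :: int
  from assms(1) obtain N where N: "N > 0"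
    "\<And>r. \<exists>p :: rat poly. \<forall>m. [m = r] (mod N) \<longrightarrow> f m = poly p (of_int m)"
    unfolding quasipolynomial_def by blast
  from assms(2) obtain M where M: "M > 0"
    "\<And>r. \<exists>p :: rat poly. \<forall>m. [m = r] (mod M) \<longrightarrow> g m = poly p (of_int m)"
    unfolding quasipolynomial_def by blast
  obtain p p' :: "rat poly" where p: "\<And>m. [m = r] (mod N) \<Longrightarrow> f m = poly p (of_int m)"
    and p': "\<And>m. [m = r] (mod M) \<Longrightarrow> g m = poly p' (of_int m)"
    using N(2) M(2) by metis
  \<comment> \<open>These are infinitely many members of the class of \<open>r\<close>; since
    \<open>N * M \<ge> 1\<close>, the added term exceeds \<open>\<bar>r\<bar>\<close> and makes them
    positive.\<close>
  define s where "s i = r + N * M * (\<bar>r\<bar> + 1 + int i)" for i :: nat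
  have s_pos: "s i > 0" for i
  proof -
    have "1 * (\<bar>r\<bar> + 1 + int i) \<le> N * M * (\<bar>r\<bar> + 1 + int i)"
      using N(1) M(1) by (intro mult_right_mono) (auto simp: zero_less_mult_iff int_one_le_iff_zero_less)
    then have "r + (\<bar>r\<bar> + 1 + int i) \<le> s i"
      by (simp add: s_def)
    then show ?thesis
      by linarith
  qed
  have "poly (p - p') (of_int (s i)) = 0" for i
  proof -
    have "[s i = r] (mod N)" "[s i = r] (mod M)"
      by (auto simp: s_def cong_iff_dvd_diff)
    moreover have "f (s i) = g (s i)"
      using eq[of "nat (s i)"] s_pos[of i] by simp
    ultimately show ?thesis
      using p p' by simp
  qed
  then have "range (\<lambda>i. of_int (s i)) \<subseteq> {x. poly (p - p') x = 0}"
    by auto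
  moreover have "infinite (range (\<lambda>i. of_int (s i) :: rat))"
    using N(1) M(1) by (intro range_inj_infinite injI) (simp add: s_def)
  ultimately have "p - p' = 0"
    using poly_roots_finite finite_subset by blast
  then show "f r = g r"
    using p[of r] p'[of r] by simp
qed

lemma quasipolynomial_residue_term:
  assumes "n > 0"
  shows "quasipolynomial (residue_term n s)"
proof -
  have "\<exists>p :: rat poly. \<forall>x. [x = r] (mod int n) \<longrightarrow> residue_term n s x = poly p (of_int x)" for r
  proof (cases "int n dvd r - int s")
    case True
    \<comment> \<open>The falling factorial of \<open>k + n - 1\<close> over
      \<open>(n - 1)!\<close>, with \<open>k = x / n - s / n\<close> substituted: each factor is
      linear in \<open>x\<close>.\<close>
    define p :: "rat poly" where "p = smult (1 / fact (n - 1))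
      (\<Prod>i = 0..<n - 1. [:of_nat n - of_nat s / of_nat n - 1 - of_nat i, 1 / of_nat n:])"
    have "residue_term n s x = poly p (of_int x)" if "[x = r] (mod int n)" for x
    proof -
      have "int n dvd (x - r) + (r - int s)"
        using that True by (intro dvd_add) (auto simp: cong_iff_dvd_diff)
      then obtain k where k: "x - int s = int n * k"
        by (auto elim: dvdE)
      then have "(of_int x :: rat) - of_nat s = of_nat n * of_int k"
        by (metis of_int_diff of_int_mult of_int_of_nat_eq)
      then have "(of_int k :: rat) = of_int x / of_nat n - of_nat s / of_nat n"
        using assms by (simp add: field_simps)
      then show ?thesis
        unfolding residue_term_eq[OF k assms] p_def gbinomial_prod_rev
        by (simp add: poly_prod add_diff_eq diff_add_eq add.commute)
    qed
    then show ?thesis by blast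
  next
    case False
    have "residue_term n s x = 0" if "[x = r] (mod int n)" for x
    proof -
      have "int n dvd (x - int s) - (r - int s)"
        using that by (simp add: cong_iff_dvd_diff)
      then have "\<not> int n dvd x - int s"
        using False by (metis dvd_diff_right_iff)
      then show ?thesis
        by (simp add: residue_term_def)
    qed
    then show ?thesis
      by (metis poly_0)
  qed
  then show ?thesis
    unfolding quasipolynomial_def using assms by (intro exI[of _ "int n"]) auto
qed

section \<open>The quasipolynomial of the group and reciprocity\<close>

lemma zero_sum_quasipoly_eq:
  "zero_sum_quasipoly TYPE('a::{ab_group_add, finite}) =
     (\<lambda>x. \<Sum>R\<in>(residual_seqs :: 'a multiset set). residue_term CARD('a) (size R) x)"
    (is "_ = ?L")
proof -
  have L: "quasipolynomial ?L"
    by (intro quasipolynomial_sum finite_residual_seqs quasipolynomial_residue_term) simp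
  have L_eq: "?L (int m) = of_nat (card (zero_sum_seqs m :: 'a multiset set))" for m
    by (simp add: card_zero_sum_seqs card_residue_fibre)
  show ?thesis
    unfolding zero_sum_quasipoly_def
    \<comment> \<open>\<open>L\<close> and \<open>L_eq\<close> give existence for the definite
      description, \<open>quasipolynomial_eqI\<close> gives uniqueness.\<close>
    by (rule the_equality) (use L L_eq in \<open>auto intro!: quasipolynomial_eqI[OF _ L]\<close>)
qed

theorem theorem1p1:
  fixes n m :: nat
  assumes "CARD('a::{ab_group_add, finite}) = n"
    and "m > 0"
  shows "zero_sum_quasipoly TYPE('a) (- int m) =
           (-1) ^ (n - 1) * of_nat (card (full_zero_sum_seqs m :: 'a multiset set))"
proof -
  have "rat_of_nat (card (full_zero_sum_seqs m :: 'a multiset set)) =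
      (-1) ^ (n - 1) * zero_sum_quasipoly TYPE('a) (- int m)"
    unfolding zero_sum_quasipoly_eq card_full_zero_sum_seqs of_nat_sum sum_distrib_left
      assms(1)[symmetric] card_residue_fibre_full[OF assms(2)] ..
  \<comment> \<open>The sign is its own inverse, so it can be moved to the other side.\<close>
  then show ?thesis
    by (simp flip: mult.assoc power_add)
qed

end
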